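(* Let $r\ge 2$ be an integer, let $\Gamma\colon \mathfrak{G}^{r}\to\mathbb{R}_{\ge 0}$ be a map that is $k$-uniform for some real $k$, $(\delta_\ast,c_\ast,C_\ast)$-smooth for some $\delta_\ast\in(0,1]$, $c_\ast>0$, $C_\ast>0$, locally $C$-Lipschitz for some $C>0$, continuous, and locally monotone, and let $\mathfrak{H}$ be a hereditary family of $r$-graphs. Suppose that $\Gamma$ is edge-stable and vertex-extendable with respect to $\mathfrak{H}$. Then $\Gamma$ is degree-stable with respect to $\mathfrak{H}$.
   Context: An $r$-graph is a set of $r$-subsets (edges) of a finite vertex set $V(\mathcal{H})$. $\mathfrak{G}^r$ is the collection of all vertex-labeled $r$-graphs and $\mathfrak{G}^r(n)$ those with $n$ vertices. $\mathcal{H}-v$ is obtained by deleting $v$ and all edges containing it. A family $\mathfrak{H}$ of $r$-graphs is hereditary if it is closed under taking (not necessarily induced) subgraphs. For $\Gamma\colon\mathfrak{G}^r\to\mathbb{R}$: $d_{\Gamma,\mathcal{H}}(v)=\Gamma(\mathcal{H})-\Gamma(\mathcal{H}-v)$; $\delta_\Gamma(\mathcal{H})$ is the minimum of these over $v$; $\mathcal{H}$ is $\Gamma$-positive if $\Gamma(\mathcal{H})>0$; $\mathrm{ex}_\Gamma(n)=\max\{\Gamma(\mathcal{H}):\mathcal{H}\in\mathfrak{G}^r(n)\}$. All $o(\cdot)$ are as $n\to\infty$, uniformly over the $r$-graphs involved. $k$-uniform: for every $n$ and every $\Gamma$-positive $\mathcal{H}\in\mathfrak{G}^r(n)$, $|\sum_v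 d_{\Gamma,\mathcal{H}}(v)-k\Gamma(\mathcal{H})|=o(\mathrm{ex}_\Gamma(n))$; $\mathrm{exdeg}_\Gamma(n)=k\,\mathrm{ex}_\Gamma(n)/n$. $(\delta_\ast,c_\ast,C_\ast)$-smooth: for every $n$ and $\delta\in[0,\delta_\ast]$, $\mathrm{ex}_\Gamma(n-\delta n)\le\mathrm{ex}_\Gamma(n)-\delta k\,\mathrm{ex}_\Gamma(n)+C_\ast\delta^{1+c_\ast}\mathrm{ex}_\Gamma(n)+o(\mathrm{ex}_\Gamma(n))$. Locally $C$-Lipschitz: for every $\Gamma$-positive $n$-vertex $\mathcal{H}$, every induced subgraph $\mathcal{H}'$ on $n'\le n$ vertices and $v\in V(\mathcal{H}')$, $d_{\Gamma,\mathcal{H}'}(v)\ge d_{\Gamma,\mathcal{H}}(v)-\frac{C(n-n')}{n}\mathrm{exdeg}_\Gamma(n)-o(\mathrm{exdeg}_\Gamma(n))$. Continuous: for every $\varepsilon>0$ there are $\delta>0,N_0$ such that for every $r$-graph $\mathcal{H}$ on $n\ge N_0$ vertices and $\mathcal{H}'\subset\mathcal{H}$ with $|\mathcal{H}'|\ge|\mathcal{H}|-\delta n^r$, $\Gamma(\mathcal{H}')\ge\Gamma(\mathcal{H})-\varepsilon\,\mathrm{ex}_\Gamma(n)$. Locally monotone: for every $\Gamma$-positive $\mathcal{H}$, subgraph $\mathcal{H}'\subset\mathcal{H}$, $v\in V(\mathcal{H}')$: $d_{\Gamma,\mathcal{H}'}(v)\le d_{\Gamma,\mathcal{H}}(v)$.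 With respect to $\mathfrak{H}$: $\Gamma$ is edge-stable if for every $\varepsilon>0$ there exist $\delta>0,N_0$ such that every $r$-graph on $n\ge N_0$ vertices with $\Gamma(\mathcal{H})\ge(1-\delta)\mathrm{ex}_\Gamma(n)$ becomes a member of $\mathfrak{H}$ after removing at most $\varepsilon n^r$ edges; $\Gamma$ is degree-stable if there are $\varepsilon>0,N_0$ such that every $r$-graph on $n\ge N_0$ vertices with $\delta_\Gamma(\mathcal{H})\ge(1-\varepsilon)\mathrm{exdeg}_\Gamma(n)$ is in $\mathfrak{H}$; $\Gamma$ is vertex-extendable if there are $\varepsilon>0,N_0$ such that for every $n\ge N_0$, every $n$-vertex $\mathcal{H}$ with $\delta_\Gamma(\mathcal{H})\ge(1-\varepsilon)\mathrm{exdeg}_\Gamma(n)$ and $\mathcal{H}-v\in\mathfrak{H}$ for some vertex $v$ satisfies $\mathcal{H}\in\mathfrak{H}$.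
   Formalization: The case k = 0 is excluded, since the claim is false there (r = 2, Γ = 1 on edgeless graphs and 0 otherwise, with the family of edgeless graphs); the maximum defining ex_Γ(n) is assumed to exist. *)

theory Defs
  imports Complex_Main "HOL-Library.Landau_Symbols" "HOL-Library.Infinite_Typeclass"
begin

(* A hypergraph is a pair (vertex set, edge set), so isolated vertices matter. *)
type_synonym 'v hgraph = "'v set \<times> 'v set set"

abbreviation verts :: "'v hgraph \<Rightarrow> 'v set" where "verts H \<equiv> fst H"
abbreviation edges :: "'v hgraph \<Rightarrow> 'v set set" where "edges H \<equiv> snd H"

definition rgraphs :: "nat \<Rightarrow> 'v hgraph set" where
  "rgraphs r = {H. finite (verts H) \<and> (\<forall>e\<in>edges H. e \<subseteq> verts H \<and> card e = r)}"

definition rgraphs_on :: "nat \<Rightarrow> nat \<Rightarrow> 'v hgraph set" where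
  "rgraphs_on r n = {H \<in> rgraphs r. card (verts H) = n}"

definition subhgraph :: "'v hgraph \<Rightarrow> 'v hgraph \<Rightarrow> bool" where
  "subhgraph H' H \<longleftrightarrow> verts H' \<subseteq> verts H \<and> edges H' \<subseteq> edges H"

definition induced :: "'v hgraph \<Rightarrow> 'v set \<Rightarrow> 'v hgraph" where
  "induced H S = (S, {e \<in> edges H. e \<subseteq> S})"

definition del_vertex :: "'v hgraph \<Rightarrow> 'v \<Rightarrow> 'v hgraph" where
  "del_vertex H v = (verts H - {v}, {e \<in> edges H. v \<notin> e})"

definition del_edges :: "'v hgraph \<Rightarrow> 'v set set \<Rightarrow> 'v hgraph" where
  "del_edges H F = (verts H, edges H - F)"

definition hereditary :: "nat \<Rightarrow> 'v hgraph set \<Rightarrow> bool" where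
  "hereditary r \<HH> \<longleftrightarrow> \<HH> \<subseteq> rgraphs r \<and>
     (\<forall>H\<in>\<HH>. \<forall>H'\<in>rgraphs r. subhgraph H' H \<longrightarrow> H' \<in> \<HH>)"

definition gdeg :: "('v hgraph \<Rightarrow> real) \<Rightarrow> 'v hgraph \<Rightarrow> 'v \<Rightarrow> real" where
  "gdeg \<Gamma> H v = \<Gamma> H - \<Gamma> (del_vertex H v)"

definition min_gdeg :: "('v hgraph \<Rightarrow> real) \<Rightarrow> 'v hgraph \<Rightarrow> real" where
  "min_gdeg \<Gamma> H = Min (gdeg \<Gamma> H ` verts H)"

(* There are infinitely many r-graphs on n vertices (the labels vary) and \<Gamma> is not assumed to be
   invariant under relabelling, so that the maximum defining ex_num exists is a separate condition. *)
definition max_exists :: "nat \<Rightarrow> ('v hgraph \<Rightarrow> real) \<Rightarrow> bool" where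
  "max_exists r \<Gamma> \<longleftrightarrow> (\<forall>n. \<exists>H\<in>rgraphs_on r n. \<forall>H'\<in>rgraphs_on r n. \<Gamma> H' \<le> \<Gamma> H)"

definition ex_num :: "nat \<Rightarrow> ('v hgraph \<Rightarrow> real) \<Rightarrow> nat \<Rightarrow> real" where
  "ex_num r \<Gamma> n = (GREATEST x. \<exists>H\<in>rgraphs_on r n. x = \<Gamma> H)"

definition exdeg :: "nat \<Rightarrow> ('v hgraph \<Rightarrow> real) \<Rightarrow> real \<Rightarrow> nat \<Rightarrow> real" where
  "exdeg r \<Gamma> k n = k * ex_num r \<Gamma> n / real n"

(* Error terms o(.): one function \<eta> of n alone serves all r-graphs on n vertices (and all \<delta>). *)

definition k_uniform :: "nat \<Rightarrow> ('v hgraph \<Rightarrow> real) \<Rightarrow> real \<Rightarrow> bool" where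
  "k_uniform r \<Gamma> k \<longleftrightarrow>
     (\<exists>\<eta> \<in> o(ex_num r \<Gamma>). \<forall>n. \<forall>H\<in>rgraphs_on r n. \<Gamma> H > 0 \<longrightarrow>
        \<bar>(\<Sum>v\<in>verts H. gdeg \<Gamma> H v) - k * \<Gamma> H\<bar> \<le> \<eta> n)"

(* Only those \<delta> are used for which n - \<delta>n is a natural number m. *)
definition smooth :: "nat \<Rightarrow> ('v hgraph \<Rightarrow> real) \<Rightarrow> real \<Rightarrow> real \<Rightarrow> real \<Rightarrow> real \<Rightarrow> bool" where
  "smooth r \<Gamma> k ds cs Cs \<longleftrightarrow>
     (\<exists>\<eta> \<in> o(ex_num r \<Gamma>). \<forall>n. \<forall>\<delta>\<in>{0..ds}. \<forall>m::nat. real m = real n - \<delta> * real n \<longrightarrow>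
        ex_num r \<Gamma> m \<le> ex_num r \<Gamma> n - \<delta> * k * ex_num r \<Gamma> n
          + Cs * \<delta> powr (1 + cs) * ex_num r \<Gamma> n + \<eta> n)"

definition locally_lipschitz :: "nat \<Rightarrow> ('v hgraph \<Rightarrow> real) \<Rightarrow> real \<Rightarrow> real \<Rightarrow> bool" where
  "locally_lipschitz r \<Gamma> k C \<longleftrightarrow>
     (\<exists>\<eta> \<in> o(exdeg r \<Gamma> k). \<forall>n. \<forall>H\<in>rgraphs_on r n. \<Gamma> H > 0 \<longrightarrow>
        (\<forall>S. S \<subseteq> verts H \<longrightarrow> (\<forall>v\<in>S.
           gdeg \<Gamma> (induced H S) v
             \<ge> gdeg \<Gamma> H v - C * (real n - real (card S)) / real n * exdeg r \<Gamma> k n - \<eta> n)))"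

definition edge_continuous :: "nat \<Rightarrow> ('v hgraph \<Rightarrow> real) \<Rightarrow> bool" where
  "edge_continuous r \<Gamma> \<longleftrightarrow>
     (\<forall>\<epsilon>>0. \<exists>\<delta>>0. \<exists>N0::nat. \<forall>n\<ge>N0. \<forall>H\<in>rgraphs_on r n. \<forall>H'\<in>rgraphs r.
        subhgraph H' H \<and> real (card (edges H')) \<ge> real (card (edges H)) - \<delta> * real n ^ r \<longrightarrow>
        \<Gamma> H' \<ge> \<Gamma> H - \<epsilon> * ex_num r \<Gamma> n)"

definition locally_monotone :: "nat \<Rightarrow> ('v hgraph \<Rightarrow> real) \<Rightarrow> bool" where
  "locally_monotone r \<Gamma> \<longleftrightarrow>
     (\<forall>H\<in>rgraphs r. \<Gamma> H > 0 \<longrightarrow> (\<forall>H'\<in>rgraphs r. subhgraph H' H \<longrightarrow>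
        (\<forall>v\<in>verts H'. gdeg \<Gamma> H' v \<le> gdeg \<Gamma> H v)))"

definition edge_stable :: "nat \<Rightarrow> ('v hgraph \<Rightarrow> real) \<Rightarrow> 'v hgraph set \<Rightarrow> bool" where
  "edge_stable r \<Gamma> \<HH> \<longleftrightarrow>
     (\<forall>\<epsilon>>0. \<exists>\<delta>>0. \<exists>N0::nat. \<forall>n\<ge>N0. \<forall>H\<in>rgraphs_on r n.
        \<Gamma> H \<ge> (1 - \<delta>) * ex_num r \<Gamma> n \<longrightarrow>
        (\<exists>F. F \<subseteq> edges H \<and> real (card F) \<le> \<epsilon> * real n ^ r \<and> del_edges H F \<in> \<HH>))"

definition degree_stable :: "nat \<Rightarrow> ('v hgraph \<Rightarrow> real) \<Rightarrow> real \<Rightarrow> 'v hgraph set \<Rightarrow> bool" where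
  "degree_stable r \<Gamma> k \<HH> \<longleftrightarrow>
     (\<exists>\<epsilon>>0. \<exists>N0::nat. \<forall>n\<ge>N0. \<forall>H\<in>rgraphs_on r n.
        min_gdeg \<Gamma> H \<ge> (1 - \<epsilon>) * exdeg r \<Gamma> k n \<longrightarrow> H \<in> \<HH>)"

definition vertex_extendable :: "nat \<Rightarrow> ('v hgraph \<Rightarrow> real) \<Rightarrow> real \<Rightarrow> 'v hgraph set \<Rightarrow> bool" where
  "vertex_extendable r \<Gamma> k \<HH> \<longleftrightarrow>
     (\<exists>\<epsilon>>0. \<exists>N0::nat. \<forall>n\<ge>N0. \<forall>H\<in>rgraphs_on r n.
        min_gdeg \<Gamma> H \<ge> (1 - \<epsilon>) * exdeg r \<Gamma> k n \<and> (\<exists>v\<in>verts H. del_vertex H v \<in> \<HH>) \<longrightarrow>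
        H \<in> \<HH>)"

end

theory Submission
  imports Defs
begin

text \<open>Let \<open>H\<close> have large minimum degree. By uniformity \<open>\<Gamma> H\<close> is close to \<open>ex_num r \<Gamma> n\<close>, so
  edge-stability yields a small set \<open>F\<close> of edges with \<open>H - F\<close> in the family, and by continuity every
  graph between \<open>H - F\<close> and \<open>H\<close> is still nearly extremal. Deleting too many vertices of low degree
  from \<open>H - F\<close> would leave a graph whose value exceeds what smoothness allows, so all but \<open>\<gamma> n\<close> vertices
  have large degree; call the set of these \<open>S\<close>. The part of \<open>H - F\<close> on \<open>S\<close> is then transformed into
  \<open>H\<close> vertex by vertex: first the edges of \<open>F\<close> inside \<open>S\<close> are put back, then the vertices outside
  \<open>S\<close>. Local monotonicity and the Lipschitz condition keep all degrees large on the way, so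
  vertex-extendability applies at each step.\<close>

section \<open>Finite r-graphs: induced subgraphs and deletion of vertices and edges\<close>

lemma rgraphs_finite:
  assumes "H \<in> rgraphs r"
  shows "finite (verts H)" "finite (edges H)"
proof -
  show fin: "finite (verts H)"
    using assms by (simp add: rgraphs_def)
  have "edges H \<subseteq> Pow (verts H)"
    using assms by (auto simp: rgraphs_def)
  then show "finite (edges H)"
    using fin by (meson finite_Pow_iff finite_subset)
qed

lemma rgraphs_onD:
  assumes "H \<in> rgraphs_on r n"
  shows "H \<in> rgraphs r" "card (verts H) = n"
  using assms by (auto simp: rgraphs_on_def)

lemma induced_rgraphs: "H \<in> rgraphs r \<Longrightarrow> S \<subseteq> verts H \<Longrightarrow> induced H S \<in> rgraphs r"
  by (auto simp: rgraphs_def induced_def intro: finite_subset)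

lemma induced_rgraphs_on:
  "H \<in> rgraphs r \<Longrightarrow> S \<subseteq> verts H \<Longrightarrow> induced H S \<in> rgraphs_on r (card S)"
  using induced_rgraphs[of H r S] by (simp add: rgraphs_on_def induced_def)

lemma induced_subhgraph: "S \<subseteq> verts H \<Longrightarrow> subhgraph (induced H S) H"
  by (auto simp: subhgraph_def induced_def)

lemma induced_verts: "H \<in> rgraphs r \<Longrightarrow> induced H (verts H) = H"
  by (cases H) (auto simp: rgraphs_def induced_def)

lemma del_vertex_rgraphs: "H \<in> rgraphs r \<Longrightarrow> del_vertex H v \<in> rgraphs r"
  by (auto simp: rgraphs_def del_vertex_def)

lemma del_vertex_rgraphs_on:
  assumes "H \<in> rgraphs_on r n" "v \<in> verts H"
  shows "del_vertex H v \<in> rgraphs_on r (n - 1)"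
  using assms del_vertex_rgraphs[of H r v] by (auto simp: rgraphs_on_def del_vertex_def)

lemma del_vertex_induced_insert:
  "v \<notin> T \<Longrightarrow> del_vertex (induced H (insert v T)) v = induced H T"
  by (auto simp: del_vertex_def induced_def)

lemma hereditaryD:
  "hereditary r \<HH> \<Longrightarrow> H \<in> \<HH> \<Longrightarrow> H' \<in> rgraphs r \<Longrightarrow> subhgraph H' H \<Longrightarrow> H' \<in> \<HH>"
  by (auto simp: hereditary_def)

lemma rgraphs_between:
  assumes "H \<in> rgraphs_on r n" "verts K = verts H" "edges K \<subseteq> edges H"
  shows "K \<in> rgraphs_on r n"
  using assms by (auto simp: rgraphs_on_def rgraphs_def)

text \<open>\<open>Min\<close> of the empty set is unspecified, hence the second assumption.\<close>

lemma min_gdeg_ge_iff: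
  assumes "finite (verts H)" "verts H \<noteq> {}"
  shows "min_gdeg \<Gamma> H \<ge> c \<longleftrightarrow> (\<forall>v\<in>verts H. gdeg \<Gamma> H v \<ge> c)"
  using assms by (simp add: min_gdeg_def)

section \<open>Growing a member of the family up to the whole graph\<close>

text \<open>The edges of \<open>F\<close> inside \<open>S\<close> are restored along a growing set \<open>U\<close> of vertices: only
  those edges are put back that lie inside \<open>U\<close>, so deleting the newest vertex leads back to a
  subgraph of the previous graph.\<close>

lemma extend_to_whole:
  assumes her: "hereditary r \<HH>" and H: "H \<in> rgraphs r" and "r > 0"
    and F: "del_edges H F \<in> \<HH>" and S: "S \<subseteq> verts H"
    and step: "\<And>K T v. \<lbrakk>verts K = verts H; edges H - F \<subseteq> edges K; edges K \<subseteq> edges H;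
        S \<subseteq> T; T \<subseteq> verts H; T = S \<or> K = H; v \<in> T; del_vertex (induced K T) v \<in> \<HH>\<rbrakk>
        \<Longrightarrow> induced K T \<in> \<HH>"
  shows "H \<in> \<HH>"
proof -
  define K where "K U = (verts H, {e \<in> edges H. e \<notin> F \<or> e \<subseteq> U})" for U
  have KR: "K U \<in> rgraphs r" for U
    using H by (auto simp: K_def rgraphs_def)
  have K_restrict: "induced (K S) S = induced H S"
    by (auto simp: K_def induced_def)
  have "finite S"
    using S rgraphs_finite(1)[OF H] by (rule finite_subset)
  have "U \<subseteq> S \<Longrightarrow> induced (K U) S \<in> \<HH>" if "finite U" for U
    using that
  proof (induction U rule: finite_induct)
    case empty
    \<comment> \<open>\<open>r > 0\<close> excludes the empty edge, the only one that
      \<open>K {}\<close> could retain from \<open>F\<close>.\<close>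
    have "subhgraph (induced (K {}) S) (del_edges H F)"
      using S \<open>r > 0\<close> H by (auto simp: subhgraph_def induced_def del_edges_def K_def rgraphs_def)
    moreover have "induced (K {}) S \<in> rgraphs r"
      using S by (intro induced_rgraphs KR) (simp add: K_def)
    ultimately show ?case
      using hereditaryD[OF her F] by blast
  next
    case (insert v U)
    have "subhgraph (del_vertex (induced (K (insert v U)) S) v) (induced (K U) S)"
      by (auto simp: subhgraph_def induced_def del_vertex_def K_def)
    moreover have "del_vertex (induced (K (insert v U)) S) v \<in> rgraphs r"
      using S by (intro del_vertex_rgraphs induced_rgraphs KR) (simp add: K_def)
    ultimately have "del_vertex (induced (K (insert v U)) S) v \<in> \<HH>"
      using hereditaryD[OF her] insert by blast
    then show ?case
      using insert.prems S by (intro step[of _ _ v]) (auto simp: K_def)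
  qed
  from this[OF \<open>finite S\<close> order.refl] have S_in: "induced H S \<in> \<HH>"
    by (simp add: K_restrict)
  \<comment> \<open>Second stage, with \<open>K = H\<close>: once \<open>induced H S\<close> is in
    the family, deleting the newest vertex gives back exactly the previous graph.\<close>
  have "Y \<subseteq> verts H - S \<Longrightarrow> induced H (S \<union> Y) \<in> \<HH>" if "finite Y" for Y
    using that
  proof (induction Y rule: finite_induct)
    case empty
    then show ?case using S_in by simp
  next
    case (insert v Y)
    then have "del_vertex (induced H (insert v (S \<union> Y))) v \<in> \<HH>"
      by (subst del_vertex_induced_insert) auto
    then show ?case
      using insert.prems S by (intro step[of _ _ v]) auto
  qed
  from this[of "verts H - S"] have "induced H (verts H) \<in> \<HH>"
    using S rgraphs_finite(1)[OF H] by (simp add: Un_absorb1)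
  then show ?thesis
    using induced_verts[OF H] by simp
qed

text \<open>The difference telescopes when the vertices of \<open>Z\<close> are deleted one by one.
  Each loss is a degree in an induced subgraph of \<open>H\<close>, which monotonicity bounds by the
  degree in \<open>H\<close> itself.\<close>

lemma gamma_diff_le_sum_gdeg:
  assumes mono: "locally_monotone r \<Gamma>" and H: "H \<in> rgraphs r" "\<Gamma> H > 0" and "Z \<subseteq> verts H"
  shows "\<Gamma> H - \<Gamma> (induced H (verts H - Z)) \<le> (\<Sum>v\<in>Z. gdeg \<Gamma> H v)"
proof -
  have "finite Z"
    using assms rgraphs_finite(1)[OF H(1)] by (simp add: finite_subset)
  then show ?thesis
    using \<open>Z \<subseteq> verts H\<close>
  proof (induction Z rule: finite_induct)
    case empty
    then show ?case by (simp add: induced_verts[OF H(1)])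
  next
    case (insert v Z)
    let ?I = "induced H (verts H - Z)"
    have "verts H - Z = insert v (verts H - insert v Z)"
      using insert by auto
    then have "del_vertex ?I v = induced H (verts H - insert v Z)"
      by (metis Diff_iff del_vertex_induced_insert insertI1)
    moreover have "gdeg \<Gamma> ?I v \<le> gdeg \<Gamma> H v"
    proof -
      have "?I \<in> rgraphs r" "subhgraph ?I H" "v \<in> verts ?I"
        using insert H by (auto intro!: induced_rgraphs induced_subhgraph) (simp add: induced_def)
      then show ?thesis
        using mono H unfolding locally_monotone_def by blast
    qed
    ultimately show ?case
      using insert by (simp add: gdeg_def)
  qed
qed

section \<open>Extremal numbers, and the error terms for large \<open>n\<close>\<close>

text \<open>\<open>GREATEST\<close> is informative only if a greatest value exists;
  \<open>max_exists\<close> provides one.\<close>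

lemma ex_num_upper:
  assumes "max_exists r \<Gamma>" "H \<in> rgraphs_on r n"
  shows "\<Gamma> H \<le> ex_num r \<Gamma> n"
proof -
  obtain M where M: "M \<in> rgraphs_on r n" "\<forall>H'\<in>rgraphs_on r n. \<Gamma> H' \<le> \<Gamma> M"
    using assms(1) unfolding max_exists_def by blast
  then have "ex_num r \<Gamma> n = \<Gamma> M"
    unfolding ex_num_def by (intro Greatest_equality) auto
  then show ?thesis using M assms(2) by simp
qed

lemma ex_num_attained:
  assumes "max_exists r \<Gamma>"
  obtains M where "M \<in> rgraphs_on r n" "\<Gamma> M = ex_num r \<Gamma> n"
proof -
  obtain M where M: "M \<in> rgraphs_on r n" "\<forall>H'\<in>rgraphs_on r n. \<Gamma> H' \<le> \<Gamma> M"
    using assms(1) unfolding max_exists_def by blast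
  then have "ex_num r \<Gamma> n = \<Gamma> M"
    unfolding ex_num_def by (intro Greatest_equality) auto
  then show ?thesis using M that by simp
qed

lemma ex_num_nonneg:
  assumes "max_exists r \<Gamma>" "\<forall>H\<in>rgraphs r. \<Gamma> H \<ge> 0"
  shows "ex_num r \<Gamma> n \<ge> 0"
  using assms by (metis ex_num_attained rgraphs_onD(1))

lemma smallo_ex_num_bound:
  assumes "\<eta> \<in> o(ex_num r \<Gamma>)" "max_exists r \<Gamma>" "\<forall>H\<in>rgraphs r. \<Gamma> H \<ge> 0" "c > 0"
  shows "eventually (\<lambda>n. \<eta> n \<le> c * ex_num r \<Gamma> n) sequentially"
proof -
  have "eventually (\<lambda>n. norm (\<eta> n) \<le> c * norm (ex_num r \<Gamma> n)) sequentially"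
    using landau_o.smallD[OF assms(1,4)] .
  then show ?thesis
    by eventually_elim (use ex_num_nonneg[OF assms(2,3)] in auto)
qed

text \<open>The little-o error becomes an arbitrarily small multiple of
  \<open>ex_num r \<Gamma> n\<close>, at the price of taking \<open>n\<close> large. The upper bound
  on the degree sum is the half that, for positive \<open>k\<close>, bounds
  \<open>\<Gamma> H\<close> from below.\<close>

lemma k_uniform_eventually:
  assumes "max_exists r \<Gamma>" "\<forall>H\<in>rgraphs r. \<Gamma> H \<ge> 0" "k_uniform r \<Gamma> k" "c > 0"
  shows "\<forall>\<^sub>F n in sequentially. \<forall>H\<in>rgraphs_on r n. \<Gamma> H > 0 \<longrightarrow>
           (\<Sum>v\<in>verts H. gdeg \<Gamma> H v) \<le> k * \<Gamma> H + c * ex_num r \<Gamma> n"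
proof -
  from assms(3) obtain \<eta> where \<eta>: "\<eta> \<in> o(ex_num r \<Gamma>)"
    and U: "\<forall>n. \<forall>H\<in>rgraphs_on r n. \<Gamma> H > 0 \<longrightarrow>
        \<bar>(\<Sum>v\<in>verts H. gdeg \<Gamma> H v) - k * \<Gamma> H\<bar> \<le> \<eta> n"
    unfolding k_uniform_def by (elim bexE)
  show ?thesis
    using smallo_ex_num_bound[OF \<eta> assms(1,2,4)]
  proof eventually_elim
    case (elim n)
    show ?case
    proof (intro ballI impI)
      fix H assume "H \<in> rgraphs_on r n" "\<Gamma> H > 0"
      with U have "\<bar>(\<Sum>v\<in>verts H. gdeg \<Gamma> H v) - k * \<Gamma> H\<bar> \<le> \<eta> n"
        by simp
      with elim show "(\<Sum>v\<in>verts H. gdeg \<Gamma> H v) \<le> k * \<Gamma> H + c * ex_num r \<Gamma> n"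
        by linarith
    qed
  qed
qed

lemma smooth_eventually:
  assumes "max_exists r \<Gamma>" "\<forall>H\<in>rgraphs r. \<Gamma> H \<ge> 0" "smooth r \<Gamma> k ds cs Cs" "c > 0"
  shows "\<forall>\<^sub>F n in sequentially. \<forall>\<delta>\<in>{0..ds}. \<forall>m. real m = real n - \<delta> * real n \<longrightarrow>
           ex_num r \<Gamma> m \<le> (1 - \<delta> * k + Cs * \<delta> powr (1 + cs) + c) * ex_num r \<Gamma> n"
proof -
  from assms(3) obtain \<eta> where \<eta>: "\<eta> \<in> o(ex_num r \<Gamma>)"
    and S: "\<forall>n. \<forall>\<delta>\<in>{0..ds}. \<forall>m::nat. real m = real n - \<delta> * real n \<longrightarrow>
        ex_num r \<Gamma> m \<le> ex_num r \<Gamma> n - \<delta> * k * ex_num r \<Gamma> n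
          + Cs * \<delta> powr (1 + cs) * ex_num r \<Gamma> n + \<eta> n"
    unfolding smooth_def by (elim bexE)
  show ?thesis
    using smallo_ex_num_bound[OF \<eta> assms(1,2,4)]
  proof eventually_elim
    case (elim n)
    show ?case
    proof (intro ballI allI impI)
      fix \<delta> :: real and m :: nat assume "\<delta> \<in> {0..ds}" "real m = real n - \<delta> * real n"
      with S have "ex_num r \<Gamma> m \<le> ex_num r \<Gamma> n - \<delta> * k * ex_num r \<Gamma> n
          + Cs * \<delta> powr (1 + cs) * ex_num r \<Gamma> n + \<eta> n"
        by blast
      with elim show "ex_num r \<Gamma> m \<le> (1 - \<delta> * k + Cs * \<delta> powr (1 + cs) + c) * ex_num r \<Gamma> n"
        by (simp add: algebra_simps)
    qed
  qed
qed

text \<open>The absolute value accommodates negative \<open>k\<close>, for which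
  \<open>exdeg\<close> can be negative.\<close>

lemma locally_lipschitz_eventually:
  assumes "locally_lipschitz r \<Gamma> k C" "c > 0"
  shows "\<forall>\<^sub>F n in sequentially. \<forall>H\<in>rgraphs_on r n. \<Gamma> H > 0 \<longrightarrow>
           (\<forall>S\<subseteq>verts H. \<forall>v\<in>S. gdeg \<Gamma> (induced H S) v \<ge> gdeg \<Gamma> H v
              - C * (real n - real (card S)) / real n * exdeg r \<Gamma> k n - c * \<bar>exdeg r \<Gamma> k n\<bar>)"
proof -
  from assms(1) obtain \<eta> where \<eta>: "\<eta> \<in> o(exdeg r \<Gamma> k)"
    and L: "\<forall>n. \<forall>H\<in>rgraphs_on r n. \<Gamma> H > 0 \<longrightarrow>
        (\<forall>S. S \<subseteq> verts H \<longrightarrow> (\<forall>v\<in>S.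
           gdeg \<Gamma> (induced H S) v
             \<ge> gdeg \<Gamma> H v - C * (real n - real (card S)) / real n * exdeg r \<Gamma> k n - \<eta> n))"
    unfolding locally_lipschitz_def by (elim bexE)
  show ?thesis
    using landau_o.smallD[OF \<eta> assms(2)]
  proof eventually_elim
    case (elim n)
    then have le: "\<eta> n \<le> c * \<bar>exdeg r \<Gamma> k n\<bar>"
      by auto
    show ?case
    proof (intro ballI allI impI)
      fix H S v assume "H \<in> rgraphs_on r n" "\<Gamma> H > 0" "S \<subseteq> verts H" "v \<in> S"
      with L have "gdeg \<Gamma> (induced H S) v
             \<ge> gdeg \<Gamma> H v - C * (real n - real (card S)) / real n * exdeg r \<Gamma> k n - \<eta> n"
        by blast
      with le show "gdeg \<Gamma> (induced H S) v \<ge> gdeg \<Gamma> H v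
              - C * (real n - real (card S)) / real n * exdeg r \<Gamma> k n - c * \<bar>exdeg r \<Gamma> k n\<bar>"
        by linarith
    qed
  qed
qed

section \<open>Negative \<open>k\<close> and vanishing extremal numbers\<close>

text \<open>For negative \<open>k\<close> the Lipschitz error has the wrong sign, and passing to a single
  vertex contradicts local monotonicity.\<close>

lemma ex_num_eventually_zero_if_neg:
  assumes max: "max_exists r \<Gamma>" and nonneg: "\<forall>H\<in>rgraphs r. \<Gamma> H \<ge> 0"
    and "k < 0" and "C > 0" and lip: "locally_lipschitz r \<Gamma> k C" and mono: "locally_monotone r \<Gamma>"
  shows "\<forall>\<^sub>F n in sequentially. ex_num r \<Gamma> n = 0"
proof -
  \<comment> \<open>Passing from \<open>n \<ge> 2\<close> vertices to one removes a fraction of at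
    least 1/2, so the Lipschitz term gains at least \<open>C / 2\<close> times
    \<open>\<bar>exdeg r \<Gamma> k n\<bar>\<close>. An error of \<open>C / 4\<close> leaves a
    strict gain.\<close>
  have "C / 4 > 0"
    using \<open>C > 0\<close> by simp
  from locally_lipschitz_eventually[OF lip this] show ?thesis
    using eventually_ge_at_top[of 2]
  proof eventually_elim
    case (elim n)
    show ?case
    proof (rule ccontr)
      assume "ex_num r \<Gamma> n \<noteq> 0"
      then have pos: "ex_num r \<Gamma> n > 0"
        using ex_num_nonneg[OF max nonneg, of n] by simp
      obtain H where H: "H \<in> rgraphs_on r n" "\<Gamma> H = ex_num r \<Gamma> n"
        by (rule ex_num_attained[OF max])
      with pos have H_pos: "\<Gamma> H > 0"
        by simp
      have "verts H \<noteq> {}"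
        using elim(2) rgraphs_onD(2)[OF H(1)] by auto
      then obtain v where v: "v \<in> verts H"
        by blast
      define x where "x = - exdeg r \<Gamma> k n"
      have "x > 0"
        using pos \<open>k < 0\<close> elim(2) by (simp add: x_def exdeg_def divide_neg_pos mult_neg_pos)
      have "gdeg \<Gamma> (induced H {v}) v \<ge> gdeg \<Gamma> H v
              - C * (real n - real (card {v})) / real n * exdeg r \<Gamma> k n
              - C / 4 * \<bar>exdeg r \<Gamma> k n\<bar>"
        using elim(1) H(1) H_pos v by (metis bot_least insert_subset insertI1)
      then have "gdeg \<Gamma> (induced H {v}) v \<ge> gdeg \<Gamma> H v + C * (real n - 1) / real n * x - C / 4 * x"
        using \<open>x > 0\<close> by (simp add: x_def)
      moreover have "gdeg \<Gamma> (induced H {v}) v \<le> gdeg \<Gamma> H v"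
      proof -
        note HR = rgraphs_onD(1)[OF H(1)]
        have "induced H {v} \<in> rgraphs r" "subhgraph (induced H {v}) H" "v \<in> verts (induced H {v})"
          using v HR by (auto intro!: induced_rgraphs induced_subhgraph) (simp add: induced_def)
        then show ?thesis
          using mono HR H_pos unfolding locally_monotone_def by blast
      qed
      moreover have "C * (real n - 1) / real n \<ge> C / 2"
        using elim(2) \<open>C > 0\<close> by (simp add: field_simps)
      then have "C * (real n - 1) / real n * x \<ge> C / 2 * x"
        using \<open>x > 0\<close> by (intro mult_right_mono) auto
      moreover have "C * x > 0"
        using \<open>x > 0\<close> \<open>C > 0\<close> by simp
      ultimately show False
        by linarith
    qed
  qed
qed

text \<open>Smoothness at \<open>1 / n\<close>, admissible once \<open>n \<ge> 1 / ds\<close>,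
  bounds the extremal number for \<open>n - 1\<close> by a multiple of that for \<open>n\<close>.
  Both orders matter because a degree compares graphs on \<open>n\<close> and \<open>n - 1\<close>
  vertices.\<close>

lemma ex_num_pred_zero:
  assumes max: "max_exists r \<Gamma>" and nonneg: "\<forall>H\<in>rgraphs r. \<Gamma> H \<ge> 0"
    and "0 < ds" and sm: "smooth r \<Gamma> k ds cs Cs"
  shows "\<forall>\<^sub>F n in sequentially. ex_num r \<Gamma> n = 0 \<longrightarrow> ex_num r \<Gamma> (n - 1) = 0"
  using smooth_eventually[OF max nonneg sm zero_less_one]
    eventually_ge_at_top[of "Suc (nat \<lceil>1/ds\<rceil>)"]
proof eventually_elim
  case (elim n)
  then have n: "real n \<ge> 1 / ds" "n \<ge> 1"
    by linarith+
  then have "1 / real n \<in> {0..ds}" "real (n - 1) = real n - 1 / real n * real n"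
    using \<open>0 < ds\<close> by (auto simp: field_simps of_nat_diff)
  with elim(1) have "ex_num r \<Gamma> (n - 1)
      \<le> (1 - 1 / real n * k + Cs * (1 / real n) powr (1 + cs) + 1) * ex_num r \<Gamma> n"
    by blast
  then show ?case
    using ex_num_nonneg[OF max nonneg, of "n - 1"] by fastforce
qed

section \<open>Degree and value estimates for nearly extremal graphs\<close>

text \<open>Deleting a fraction \<open>\<delta>\<close> of the vertices, all of low degree, costs at
  most \<open>\<delta> * (1 - \<beta>) * k * ex_num r \<Gamma> n\<close>, while smoothness forces a
  loss of almost \<open>\<delta> * k * ex_num r \<Gamma> n\<close>. For \<open>\<delta>\<close>
  close to \<open>\<gamma>\<close> the gap beats all error terms.\<close>

lemma card_low_degree_le:
  assumes max: "max_exists r \<Gamma>" and mono: "locally_monotone r \<Gamma>"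
    and K: "K \<in> rgraphs_on r n" "\<Gamma> K > 0" "\<Gamma> K \<ge> (1 - \<omega>) * ex_num r \<Gamma> n"
    and sm: "\<forall>\<delta>\<in>{0..ds}. \<forall>m. real m = real n - \<delta> * real n \<longrightarrow>
           ex_num r \<Gamma> m \<le> (1 - \<delta> * k + Cs * \<delta> powr (1 + cs) + \<omega>) * ex_num r \<Gamma> n"
    and pos: "ex_num r \<Gamma> n > 0" "k > 0" "\<beta> > 0" "Cs > 0" "cs > 0"
    and \<gamma>: "0 < \<gamma>" "\<gamma> \<le> ds" "\<gamma> \<le> 1" "Cs * \<gamma> powr cs \<le> \<beta> * k / 3" "2 * \<omega> < \<gamma> * \<beta> * k / 3"
    and n: "real n \<ge> 2 / \<gamma>"
  shows "real (card {v \<in> verts K. gdeg \<Gamma> K v < (1 - \<beta>) * exdeg r \<Gamma> k n}) \<le> \<gamma> * real n"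
proof (rule ccontr)
  define Z where "Z = {v \<in> verts K. gdeg \<Gamma> K v < (1 - \<beta>) * exdeg r \<Gamma> k n}"
  \<comment> \<open>Rounding down makes \<open>n - \<delta> * n\<close> a natural number, as
    smoothness requires; \<open>n \<ge> 2 / \<gamma>\<close> keeps \<open>\<delta>\<close> at least
    \<open>\<gamma> / 2\<close>.\<close>
  define p where "p = nat \<lfloor>\<gamma> * real n\<rfloor>"
  define \<delta> where "\<delta> = real p / real n"
  let ?ex = "ex_num r \<Gamma> n"
  assume "\<not> ?thesis"
  then have Z_gt: "real (card Z) > \<gamma> * real n"
    by (simp add: Z_def)
  have "n > 0"
    using n \<gamma>(1) by (smt (verit) divide_pos_pos gr0I of_nat_0)
  have "\<gamma> * real n \<ge> 2"
    using n \<gamma>(1) by (simp add: field_simps)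
  then have p: "real p \<le> \<gamma> * real n" "real p \<ge> \<gamma> * real n - 1"
    unfolding p_def by linarith+
  then have \<delta>: "\<delta> \<le> \<gamma>" "\<delta> \<ge> \<gamma> / 2" "\<delta> * real n = real p"
    using \<open>n > 0\<close> \<open>\<gamma> * real n \<ge> 2\<close> by (simp_all add: \<delta>_def field_simps)
  have "\<delta> > 0"
    using \<delta>(2) \<gamma>(1) by linarith
  have "p \<le> card Z"
    using p(1) Z_gt by linarith
  then obtain Y where Y: "Y \<subseteq> Z" "card Y = p"
    by (meson obtain_subset_with_card_n)
  have finK: "finite (verts K)" and KR: "K \<in> rgraphs r" and cardK: "card (verts K) = n"
    using rgraphs_finite(1)[of K r] rgraphs_onD[OF K(1)] by blast+
  have YK: "Y \<subseteq> verts K"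
    using Y(1) by (auto simp: Z_def)
  have "p \<le> n"
    using card_mono[OF finK YK] cardK Y(2) by simp
  then have "real (card (verts K - Y)) = real n - real p"
    using YK finK cardK Y(2) by (simp add: card_Diff_subset finite_subset of_nat_diff)
  moreover have "\<delta> \<in> {0..ds}"
    using \<delta>(1) \<gamma>(2) \<open>\<delta> > 0\<close> by simp
  ultimately have "ex_num r \<Gamma> (card (verts K - Y)) \<le> (1 - \<delta> * k + Cs * \<delta> powr (1 + cs) + \<omega>) * ?ex"
    using sm \<delta>(3) by auto
  then have up: "\<Gamma> (induced K (verts K - Y)) \<le> (1 - \<delta> * k + Cs * \<delta> powr (1 + cs) + \<omega>) * ?ex"
    using ex_num_upper[OF max induced_rgraphs_on[OF KR, of "verts K - Y"]] by simp
  have "(\<Sum>v\<in>Y. gdeg \<Gamma> K v) \<le> (\<Sum>v\<in>Y. (1 - \<beta>) * exdeg r \<Gamma> k n)"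
    using Y(1) by (intro sum_mono) (auto simp: Z_def)
  also have "\<dots> = \<delta> * (1 - \<beta>) * k * ?ex"
    using Y(2) \<open>n > 0\<close> by (simp add: \<delta>_def exdeg_def)
  finally have "\<Gamma> K - \<Gamma> (induced K (verts K - Y)) \<le> \<delta> * (1 - \<beta>) * k * ?ex"
    using gamma_diff_le_sum_gdeg[OF mono KR K(2) YK] by linarith
  with up K(3) have "(1 - \<omega>) * ?ex
      \<le> (\<delta> * (1 - \<beta>) * k + (1 - \<delta> * k + Cs * \<delta> powr (1 + cs) + \<omega>)) * ?ex"
    unfolding distrib_right by linarith
  then have "1 - \<omega> \<le> \<delta> * (1 - \<beta>) * k + (1 - \<delta> * k + Cs * \<delta> powr (1 + cs) + \<omega>)"
    using pos(1) by (simp add: mult_le_cancel_right)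
  \<comment> \<open>One \<open>\<omega>\<close> is the deficit of \<open>K\<close>, the other the
    smoothness error.\<close>
  then have main: "\<delta> * (\<beta> * k) \<le> 2 * \<omega> + Cs * \<delta> powr (1 + cs)"
    by (simp add: algebra_simps)
  \<comment> \<open>The superlinear term uses up at most a third of the left side of
    \<open>main\<close>. By \<open>\<delta> \<ge> \<gamma> / 2\<close> the other two thirds are at
    least \<open>\<gamma> * \<beta> * k / 3\<close>, which exceeds
    \<open>2 * \<omega>\<close>.\<close>
  have "\<delta> powr cs \<le> \<gamma> powr cs"
    using \<delta>(1) \<open>\<delta> > 0\<close> pos(5) by (intro powr_mono2) auto
  then have "Cs * \<delta> powr cs \<le> \<beta> * k / 3"
    using \<gamma>(4) pos(4) by (smt (verit) mult_left_mono)
  then have "\<delta> * (Cs * \<delta> powr cs) \<le> \<delta> * (\<beta> * k / 3)"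
    using \<open>\<delta> > 0\<close> by (intro mult_left_mono) auto
  also have "\<delta> * (Cs * \<delta> powr cs) = Cs * \<delta> powr (1 + cs)"
    using \<open>\<delta> > 0\<close> by (simp add: powr_add)
  finally have "Cs * \<delta> powr (1 + cs) \<le> \<delta> * (\<beta> * k) / 3"
    by simp
  moreover have "\<gamma> / 2 * (\<beta> * k) \<le> \<delta> * (\<beta> * k)"
    using \<delta>(2) pos by (intro mult_right_mono) auto
  ultimately show False
    using main \<gamma>(5) by (simp add: mult.assoc)
qed

text \<open>Two losses are combined: the Lipschitz condition lowers the degree of \<open>v\<close>,
  and the reference value changes from \<open>exdeg\<close> at \<open>n\<close> to
  \<open>exdeg\<close> at \<open>card T\<close>, which smoothness controls. The budget
  \<open>e\<close> pays for both and for \<open>\<beta>\<close>.\<close>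

lemma gdeg_induced_ge:
  assumes lip: "\<forall>H\<in>rgraphs_on r n. \<Gamma> H > 0 \<longrightarrow>
           (\<forall>S\<subseteq>verts H. \<forall>v\<in>S. gdeg \<Gamma> (induced H S) v \<ge> gdeg \<Gamma> H v
              - C * (real n - real (card S)) / real n * exdeg r \<Gamma> k n - \<tau> * \<bar>exdeg r \<Gamma> k n\<bar>)"
    and sm: "\<forall>\<delta>\<in>{0..ds}. \<forall>m. real m = real n - \<delta> * real n \<longrightarrow>
           ex_num r \<Gamma> m \<le> (1 - \<delta> * k + Cs * \<delta> powr (1 + cs) + \<tau>) * ex_num r \<Gamma> n"
    and K: "K \<in> rgraphs_on r n" "\<Gamma> K > 0"
    and T: "T \<subseteq> verts K" "real (card T) \<ge> (1 - \<gamma>) * real n" "v \<in> T"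
    and deg: "gdeg \<Gamma> K v \<ge> (1 - \<beta>) * exdeg r \<Gamma> k n"
    and pos: "ex_num r \<Gamma> n > 0" "k > 0" "\<beta> > 0" "C > 0" "Cs > 0" "cs > 0" "n > 0" "\<tau> > 0"
    and \<gamma>: "0 < \<gamma>" "\<gamma> \<le> ds" "\<gamma> < 1" "\<gamma> * (1 + C + Cs) + 2 * \<tau> + \<beta> \<le> e" "e \<le> 1"
  shows "gdeg \<Gamma> (induced K T) v \<ge> (1 - e) * exdeg r \<Gamma> k (card T)"
proof -
  let ?x = "exdeg r \<Gamma> k n"
  define m where "m = card T"
  define \<delta> where "\<delta> = (real n - real m) / real n"
  have "?x > 0"
    using pos by (simp add: exdeg_def)
  have "m \<le> n"
    using T(1) rgraphs_onD[OF K(1)] by (auto simp: m_def rgraphs_finite(1) card_mono)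
  then have \<delta>: "0 \<le> \<delta>" "\<delta> \<le> \<gamma>" "real m = real n - \<delta> * real n"
    using T(2) pos(7) by (simp_all add: \<delta>_def m_def field_simps)
  have gn: "0 < (1 - \<gamma>) * real n"
    using \<gamma> pos(7) by simp
  \<comment> \<open>A linear bound suffices here, and it follows from
    \<open>\<delta> \<le> \<gamma> < 1\<close>.\<close>
  have "\<delta> powr (1 + cs) \<le> \<delta>"
    using \<delta> \<gamma>(3) pos(6) powr_mono'[of 1 "1 + cs" \<delta>] by simp
  then have "Cs * \<delta> powr (1 + cs) \<le> Cs * \<gamma>"
    using \<delta>(2) pos(5) by (intro mult_left_mono) auto
  moreover have "\<delta> * k \<ge> 0"
    using \<delta>(1) pos(2) by simp
  ultimately have coeff: "1 - \<delta> * k + Cs * \<delta> powr (1 + cs) + \<tau> \<le> 1 + Cs * \<gamma> + \<tau>"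
    by linarith
  have "ex_num r \<Gamma> m \<le> (1 - \<delta> * k + Cs * \<delta> powr (1 + cs) + \<tau>) * ex_num r \<Gamma> n"
    using sm \<delta> \<gamma>(2) by auto
  also have "\<dots> \<le> (1 + Cs * \<gamma> + \<tau>) * ex_num r \<Gamma> n"
    using coeff pos(1) by (intro mult_right_mono) auto
  finally have ex_m: "ex_num r \<Gamma> m \<le> (1 + Cs * \<gamma> + \<tau>) * ex_num r \<Gamma> n" .
  have "exdeg r \<Gamma> k m \<le> k * ((1 + Cs * \<gamma> + \<tau>) * ex_num r \<Gamma> n) / ((1 - \<gamma>) * real n)"
    unfolding exdeg_def
  proof (rule frac_le)
    show "0 \<le> k * ((1 + Cs * \<gamma> + \<tau>) * ex_num r \<Gamma> n)"
      using pos \<gamma>(1) by simp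
  qed (use ex_m gn T(2) pos(2) in \<open>auto simp: m_def\<close>)
  also have "\<dots> = (1 + Cs * \<gamma> + \<tau>) / (1 - \<gamma>) * ?x"
    by (simp add: exdeg_def field_simps)
  finally have "(1 - e) * exdeg r \<Gamma> k m \<le> (1 - e) * ((1 + Cs * \<gamma> + \<tau>) / (1 - \<gamma>) * ?x)"
    using \<gamma>(5) by (intro mult_left_mono) auto
  also have "\<dots> = ((1 - e) * (1 + Cs * \<gamma> + \<tau>) / (1 - \<gamma>)) * ?x"
    by simp
  also have "\<dots> \<le> (1 - (\<beta> + C * \<gamma> + \<tau>)) * ?x"
  proof (intro mult_right_mono)
    have sum: "0 \<le> \<gamma> * (1 + C + Cs)"
      using pos \<gamma>(1) by simp
    have "0 \<le> e"
      using sum pos \<gamma>(4) by linarith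
    \<comment> \<open>After expansion the first-order terms are those of the budget inequality;
      these two second-order products have the favourable sign.\<close>
    then have "0 \<le> e * (Cs * \<gamma> + \<tau>)" "0 \<le> \<gamma> * (\<beta> + C * \<gamma> + \<tau>)"
      using pos \<gamma>(1) by simp_all
    then have "(1 - e) * (1 + Cs * \<gamma> + \<tau>) \<le> (1 - (\<beta> + C * \<gamma> + \<tau>)) * (1 - \<gamma>)"
      using \<gamma>(4) by (simp add: algebra_simps)
    then show "(1 - e) * (1 + Cs * \<gamma> + \<tau>) / (1 - \<gamma>) \<le> 1 - (\<beta> + C * \<gamma> + \<tau>)"
      using \<gamma>(3) by (simp add: pos_divide_le_eq)
  qed (use \<open>?x > 0\<close> in simp)
  also have "\<dots> \<le> (1 - \<beta>) * ?x - C * \<delta> * ?x - \<tau> * ?x"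
  proof -
    have "C * \<delta> * ?x \<le> C * \<gamma> * ?x"
      using \<delta>(2) pos(4) \<open>?x > 0\<close> by (intro mult_right_mono mult_left_mono) auto
    then show ?thesis
      by (simp add: algebra_simps)
  qed
  also have "\<dots> \<le> gdeg \<Gamma> K v - C * \<delta> * ?x - \<tau> * ?x"
    using deg by simp
  also have "\<dots> = gdeg \<Gamma> K v - C * (real n - real (card T)) / real n * ?x - \<tau> * \<bar>?x\<bar>"
    using \<open>?x > 0\<close> by (simp add: \<delta>_def m_def)
  also have "\<dots> \<le> gdeg \<Gamma> (induced K T) v"
    using lip K T by blast
  finally show ?thesis
    by (simp add: m_def)
qed

text \<open>A vertex of positive degree makes \<open>\<Gamma> H\<close> positive, since
  \<open>\<Gamma>\<close> is nonnegative after its deletion. Uniformity then applies, and summing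
  the degree bound over all \<open>n\<close> vertices turns \<open>exdeg\<close> into
  \<open>k * ex_num r \<Gamma> n\<close>.\<close>

lemma gamma_ge_if_min_gdeg_ge:
  assumes nonneg: "\<forall>H\<in>rgraphs r. \<Gamma> H \<ge> 0"
    and unif: "\<forall>H\<in>rgraphs_on r n. \<Gamma> H > 0 \<longrightarrow>
           (\<Sum>v\<in>verts H. gdeg \<Gamma> H v) \<le> k * \<Gamma> H + k * \<omega> * ex_num r \<Gamma> n"
    and H: "H \<in> rgraphs_on r n" and deg: "\<And>v. v \<in> verts H \<Longrightarrow> gdeg \<Gamma> H v \<ge> (1 - \<epsilon>) * exdeg r \<Gamma> k n"
    and pos: "ex_num r \<Gamma> n > 0" "k > 0" "n > 0" "\<epsilon> < 1"
  shows "\<Gamma> H > 0" "\<Gamma> H \<ge> (1 - (\<epsilon> + \<omega>)) * ex_num r \<Gamma> n"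
proof -
  have HR: "H \<in> rgraphs r" "card (verts H) = n"
    using H by (auto dest: rgraphs_onD)
  then have "verts H \<noteq> {}"
    using pos(3) by auto
  then obtain v where v: "v \<in> verts H"
    by blast
  have "(1 - \<epsilon>) * exdeg r \<Gamma> k n > 0"
    using pos by (simp add: exdeg_def)
  then have "gdeg \<Gamma> H v > 0"
    using deg[OF v] by linarith
  moreover have "\<Gamma> (del_vertex H v) \<ge> 0"
    using nonneg del_vertex_rgraphs[OF HR(1)] by blast
  ultimately show "\<Gamma> H > 0"
    by (simp add: gdeg_def)
  have "(1 - \<epsilon>) * (k * ex_num r \<Gamma> n) = (\<Sum>v\<in>verts H. (1 - \<epsilon>) * exdeg r \<Gamma> k n)"
    using HR(2) pos(3) by (simp add: exdeg_def)
  also have "\<dots> \<le> (\<Sum>v\<in>verts H. gdeg \<Gamma> H v)"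
    by (intro sum_mono deg)
  also have "\<dots> \<le> k * \<Gamma> H + k * \<omega> * ex_num r \<Gamma> n"
    using unif H \<open>\<Gamma> H > 0\<close> by blast
  finally have "k * ((1 - (\<epsilon> + \<omega>)) * ex_num r \<Gamma> n) \<le> k * \<Gamma> H"
    by (simp add: algebra_simps)
  then show "\<Gamma> H \<ge> (1 - (\<epsilon> + \<omega>)) * ex_num r \<Gamma> n"
    using pos(2) by simp
qed

text \<open>All graphs on \<open>n\<close> and \<open>n - 1\<close> vertices have value 0, so all
  degrees on \<open>n\<close> vertices are 0 and the degree condition for extension reads
  \<open>0 \<le> 0\<close>.\<close>

lemma in_family_if_ex_num_zero:
  assumes max: "max_exists r \<Gamma>" and nonneg: "\<forall>H\<in>rgraphs r. \<Gamma> H \<ge> 0"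
    and zero: "ex_num r \<Gamma> n = 0" "ex_num r \<Gamma> (n - 1) = 0"
    and her: "hereditary r \<HH>" "r > 0" and H: "H \<in> rgraphs_on r n" and F: "del_edges H F \<in> \<HH>"
    and ext: "\<And>G v. \<lbrakk>G \<in> rgraphs_on r n; min_gdeg \<Gamma> G \<ge> (1 - e) * exdeg r \<Gamma> k n; v \<in> verts G;
        del_vertex G v \<in> \<HH>\<rbrakk> \<Longrightarrow> G \<in> \<HH>"
  shows "H \<in> \<HH>"
\<comment> \<open>With \<open>S = verts H\<close> only edges are restored, so every graph to be
  extended has exactly \<open>n\<close> vertices.\<close>
proof (rule extend_to_whole[OF her(1) rgraphs_onD(1)[OF H] her(2) F order.refl])
  have vanish: "\<Gamma> G = 0" if "G \<in> rgraphs_on r m" "ex_num r \<Gamma> m = 0" for G m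
    using ex_num_upper[OF max that(1)] nonneg rgraphs_onD(1)[OF that(1)] that(2) by force
  fix K T v
  assume K: "verts K = verts H" "edges K \<subseteq> edges H" and T: "verts H \<subseteq> T" "T \<subseteq> verts H" "v \<in> T"
    and del: "del_vertex (induced K T) v \<in> \<HH>"
  have KR: "K \<in> rgraphs_on r n"
    using rgraphs_between[OF H K] .
  then have fin: "finite (verts K)"
    using rgraphs_finite(1)[of K r] rgraphs_onD by blast
  have KT: "induced K T = K"
    using induced_verts[OF rgraphs_onD(1)[OF KR]] T K(1) by auto
  have v: "v \<in> verts K"
    using T K(1) by auto
  have "gdeg \<Gamma> K u = 0" if "u \<in> verts K" for u
    using vanish[OF KR zero(1)] vanish[OF del_vertex_rgraphs_on[OF KR that] zero(2)]
    by (simp add: gdeg_def)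
  then have "min_gdeg \<Gamma> K \<ge> (1 - e) * exdeg r \<Gamma> k n"
    using fin v zero(1) by (subst min_gdeg_ge_iff) (auto simp: exdeg_def)
  then show "induced K T \<in> \<HH>"
    using ext[OF KR] v del KT by simp
qed

section \<open>Choice of the constants and the final extension argument\<close>

theorem theorem1p7:
  fixes \<Gamma> :: "'v::infinite hgraph \<Rightarrow> real"
    and \<HH> :: "'v hgraph set"
    and r :: nat
    and k ds cs Cs C :: real
  assumes "r \<ge> 2"
    and "\<forall>H\<in>rgraphs r. \<Gamma> H \<ge> 0"
    and "max_exists r \<Gamma>"
    and "k \<noteq> 0" and "k_uniform r \<Gamma> k"
    and "0 < ds" and "ds \<le> 1" and "cs > 0" and "Cs > 0" and "smooth r \<Gamma> k ds cs Cs"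
    and "C > 0" and "locally_lipschitz r \<Gamma> k C"
    and "edge_continuous r \<Gamma>"
    and "locally_monotone r \<Gamma>"
    and "hereditary r \<HH>"
    and "edge_stable r \<Gamma> \<HH>"
    and "vertex_extendable r \<Gamma> k \<HH>"
  shows "degree_stable r \<Gamma> k \<HH>"
proof -
  note nonneg = assms(2) and max = assms(3) and mono = assms(14) and her = assms(15)
  have "r > 0"
    using assms(1) by simp
  obtain \<epsilon>0 N0 where \<epsilon>0: "\<epsilon>0 > 0"
    and ext: "\<forall>n\<ge>N0. \<forall>H\<in>rgraphs_on r n.
        min_gdeg \<Gamma> H \<ge> (1 - \<epsilon>0) * exdeg r \<Gamma> k n \<and> (\<exists>v\<in>verts H. del_vertex H v \<in> \<HH>) \<longrightarrow> H \<in> \<HH>"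
    using assms(17) unfolding vertex_extendable_def by (elim exE conjE)
  \<comment> \<open>When the extremal numbers vanish, any \<open>F\<close> leading into the family
    will do; the tolerance 1 is arbitrary.\<close>
  obtain \<delta>1 N1 where N1: "\<forall>n\<ge>N1. \<forall>H\<in>rgraphs_on r n. \<Gamma> H \<ge> (1 - \<delta>1) * ex_num r \<Gamma> n \<longrightarrow>
        (\<exists>F. F \<subseteq> edges H \<and> real (card F) \<le> 1 * real n ^ r \<and> del_edges H F \<in> \<HH>)"
    using assms(16) zero_less_one unfolding edge_stable_def by metis
  have zero_case: "H \<in> \<HH>"
    if n: "n \<ge> N0" "n \<ge> N1" and zero: "ex_num r \<Gamma> n = 0" "ex_num r \<Gamma> (n - 1) = 0" and H: "H \<in> rgraphs_on r n" for n H
  proof -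
    have "\<Gamma> H \<ge> (1 - \<delta>1) * ex_num r \<Gamma> n"
      using nonneg zero(1) rgraphs_onD(1)[OF H] by simp
    then obtain F where F: "del_edges H F \<in> \<HH>"
      using N1 n(2) H by blast
    show ?thesis
      by (rule in_family_if_ex_num_zero[OF max nonneg zero her \<open>r > 0\<close> H F])
        (use ext n(1) in blast)
  qed
  show ?thesis
  proof (cases "k < 0")
    case True
    have "\<forall>\<^sub>F n in sequentially. ex_num r \<Gamma> n = 0"
      using ex_num_eventually_zero_if_neg[OF max nonneg True assms(11,12) mono] .
    then obtain N where N: "\<And>n. n \<ge> N \<Longrightarrow> ex_num r \<Gamma> n = 0"
      by (auto simp: eventually_sequentially)
    \<comment> \<open>\<open>Suc N\<close> ensures that \<open>n - 1\<close> is beyond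
      \<open>N\<close> as well.\<close>
    have "\<forall>n\<ge>Max {N0, N1, Suc N}. \<forall>H\<in>rgraphs_on r n. H \<in> \<HH>"
      using zero_case N by auto
    then show ?thesis
      unfolding degree_stable_def using zero_less_one by blast
  next
    case False
    then have "k > 0"
      using assms(4) by simp
    \<comment> \<open>The budget \<open>e\<close> is split as \<open>e / 2\<close> for
      \<open>\<gamma> * (1 + C + Cs)\<close>, \<open>e / 4\<close> for \<open>2 * \<tau>\<close> and
      \<open>e / 4\<close> for \<open>\<beta>\<close>.\<close>
    define e where "e = min \<epsilon>0 (1/2)"
    define \<beta> where "\<beta> = e / 4"
    define \<tau> where "\<tau> = e / 8"
    \<comment> \<open>The entries give, in order: the range of smoothness, at least half of the
      vertices kept, the share \<open>e / 2\<close>, and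
      \<open>Cs * \<gamma> powr cs \<le> \<beta> * k / 3\<close>.\<close>
    define \<gamma> where "\<gamma> = Min {ds, 1/2, e / (2 * (1 + C + Cs)), (\<beta> * k / (3 * Cs)) powr (1 / cs)}"
    \<comment> \<open>The entries keep \<open>1 - 3 * \<sigma>\<close> positive, make
      \<open>\<epsilon> \<le> \<beta>\<close> below, and let \<open>3 * \<sigma>\<close> serve as
      \<open>\<omega>\<close> in \<open>card_low_degree_le\<close>.\<close>
    define \<sigma> where "\<sigma> = Min {1/4, \<beta>, \<gamma> * \<beta> * k / 24}"
    have e: "0 < e" "e \<le> \<epsilon>0" "e \<le> 1/2"
      using \<epsilon>0 by (auto simp: e_def)
    have bt: "\<beta> > 0" "\<tau> > 0"
      using e by (auto simp: \<beta>_def \<tau>_def)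
    have \<gamma>: "0 < \<gamma>" "\<gamma> \<le> ds" "\<gamma> \<le> 1/2"
    proof -
      show "0 < \<gamma>"
        using bt e assms(6-11) \<open>k > 0\<close> by (simp add: \<gamma>_def)
      show "\<gamma> \<le> ds" "\<gamma> \<le> 1/2"
        unfolding \<gamma>_def by (rule Min_le; simp)+
    qed
    have "\<gamma> \<le> e / (2 * (1 + C + Cs))"
      by (simp add: \<gamma>_def)
    then have "\<gamma> * (1 + C + Cs) \<le> e / 2"
      using assms(9,11) by (simp add: field_simps)
    then have \<gamma>e: "\<gamma> * (1 + C + Cs) + 2 * \<tau> + \<beta> \<le> e"
      by (simp add: \<beta>_def \<tau>_def)
    have "\<gamma> \<le> (\<beta> * k / (3 * Cs)) powr (1 / cs)"
      by (simp add: \<gamma>_def)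
    then have "\<gamma> powr cs \<le> ((\<beta> * k / (3 * Cs)) powr (1 / cs)) powr cs"
      using \<gamma>(1) assms(8) by (intro powr_mono2) auto
    also have "\<dots> = \<beta> * k / (3 * Cs)"
      using assms(8,9) bt \<open>k > 0\<close> by (simp add: powr_powr)
    finally have \<gamma>cs: "Cs * \<gamma> powr cs \<le> \<beta> * k / 3"
      using assms(9) by (simp add: field_simps)
    have "\<gamma> * \<beta> * k > 0"
      using \<gamma>(1) bt \<open>k > 0\<close> by simp
    then have \<sigma>: "0 < \<sigma>" "\<sigma> \<le> 1/4" "\<sigma> \<le> \<beta>" "2 * (3 * \<sigma>) < \<gamma> * \<beta> * k / 3"
    proof -
      show "0 < \<sigma>" "\<sigma> \<le> 1/4" "\<sigma> \<le> \<beta>"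
        using bt \<open>\<gamma> * \<beta> * k > 0\<close> by (auto simp: \<sigma>_def)
      have "\<sigma> \<le> \<gamma> * \<beta> * k / 24"
        by (simp add: \<sigma>_def)
      then show "2 * (3 * \<sigma>) < \<gamma> * \<beta> * k / 3"
        using \<open>\<gamma> * \<beta> * k > 0\<close> by linarith
    qed
    \<comment> \<open>Continuity comes first: its edge tolerance \<open>\<delta>c\<close> is then
      the accuracy demanded of edge-stability.\<close>
    obtain \<delta>c Nc where \<delta>c: "\<delta>c > 0" and cont: "\<forall>n\<ge>Nc. \<forall>H\<in>rgraphs_on r n. \<forall>H'\<in>rgraphs r.
        subhgraph H' H \<and> real (card (edges H')) \<ge> real (card (edges H)) - \<delta>c * real n ^ r \<longrightarrow>
        \<Gamma> H' \<ge> \<Gamma> H - \<sigma> * ex_num r \<Gamma> n"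
      using assms(13) \<sigma>(1) unfolding edge_continuous_def by metis
    obtain \<delta>e Ne where \<delta>e: "\<delta>e > 0" and stab: "\<forall>n\<ge>Ne. \<forall>H\<in>rgraphs_on r n. \<Gamma> H \<ge> (1 - \<delta>e) * ex_num r \<Gamma> n \<longrightarrow>
        (\<exists>F. F \<subseteq> edges H \<and> real (card F) \<le> \<delta>c * real n ^ r \<and> del_edges H F \<in> \<HH>)"
      using assms(16) \<delta>c unfolding edge_stable_def by metis
    \<comment> \<open>\<open>H\<close> falls short of the extremal value by
      \<open>\<epsilon>\<close> through its degrees and by another \<open>\<epsilon>\<close> through
      uniformity, hence half of \<open>\<delta>e\<close>.\<close>
    define \<epsilon> where "\<epsilon> = min \<sigma> (\<delta>e / 2)"
    have \<epsilon>: "\<epsilon> > 0" "\<epsilon> \<le> \<sigma>" "\<epsilon> \<le> \<delta>e / 2"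
      using \<sigma>(1) \<delta>e by (auto simp: \<epsilon>_def)
    have "k * \<epsilon> > 0" "3 * \<sigma> > 0"
      using \<epsilon>(1) \<sigma>(1) \<open>k > 0\<close> by auto
    \<comment> \<open>Smoothness is used with error \<open>3 * \<sigma>\<close> to count low-degree
      vertices and with error \<open>\<tau>\<close> to compare \<open>exdeg\<close> at two orders.
      The threshold \<open>2 * N0\<close> leaves at least \<open>N0\<close> vertices in each induced
      graph.\<close>
    have "\<forall>\<^sub>F n in sequentially. \<forall>H\<in>rgraphs_on r n. min_gdeg \<Gamma> H \<ge> (1 - \<epsilon>) * exdeg r \<Gamma> k n \<longrightarrow> H \<in> \<HH>"
      using k_uniform_eventually[OF max nonneg assms(5) \<open>k * \<epsilon> > 0\<close>]
        smooth_eventually[OF max nonneg assms(10) \<open>3 * \<sigma> > 0\<close>]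
        smooth_eventually[OF max nonneg assms(10) bt(2)]
        locally_lipschitz_eventually[OF assms(12) bt(2)]
        ex_num_pred_zero[OF max nonneg assms(6,10)]
        eventually_ge_at_top[of "Max {2 * N0, N1, Nc, Ne, 1, nat \<lceil>2 / \<gamma>\<rceil>}"]
    proof eventually_elim
      case (elim n)
      note unif = elim(1) and sm\<sigma> = elim(2) and sm\<tau> = elim(3) and lip = elim(4)
      have n: "n \<ge> 2 * N0" "n \<ge> N1" "n \<ge> Nc" "n \<ge> Ne" "n > 0" and n\<gamma>: "real n \<ge> 2 / \<gamma>"
      proof -
        have "n \<ge> nat \<lceil>2 / \<gamma>\<rceil>"
          using elim(6) by simp
        then show "real n \<ge> 2 / \<gamma>"
          by linarith
      qed (use elim(6) in simp_all)
      show ?case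
      proof (intro ballI impI)
        fix H assume H: "H \<in> rgraphs_on r n" and Hmin: "min_gdeg \<Gamma> H \<ge> (1 - \<epsilon>) * exdeg r \<Gamma> k n"
        show "H \<in> \<HH>"
        \<comment> \<open>For positive \<open>k\<close> too, single extremal numbers may vanish;
          positivity of \<open>\<Gamma> H\<close> is available only otherwise.\<close>
        proof (cases "ex_num r \<Gamma> n = 0")
          case True
          then show ?thesis
            using zero_case[of n H] n elim(5) H by auto
        next
          case False
          then have ex_pos: "ex_num r \<Gamma> n > 0"
            using ex_num_nonneg[OF max nonneg, of n] by simp
          have HR: "H \<in> rgraphs r" "card (verts H) = n" "finite (verts H)" "finite (edges H)"
            using rgraphs_onD[OF H] rgraphs_finite[of H r] by blast+
          have "verts H \<noteq> {}"
            using HR n by auto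
          then have Hdeg: "\<And>v. v \<in> verts H \<Longrightarrow> gdeg \<Gamma> H v \<ge> (1 - \<epsilon>) * exdeg r \<Gamma> k n"
            using Hmin min_gdeg_ge_iff HR(3) by blast
          have "\<epsilon> < 1"
            using \<epsilon> \<sigma> by linarith
          note H\<Gamma> = gamma_ge_if_min_gdeg_ge[OF nonneg unif H Hdeg ex_pos \<open>k > 0\<close> \<open>n > 0\<close> \<open>\<epsilon> < 1\<close>]
          have "(1 - \<delta>e) * ex_num r \<Gamma> n \<le> (1 - (\<epsilon> + \<epsilon>)) * ex_num r \<Gamma> n"
            using \<epsilon> ex_pos by (intro mult_right_mono) auto
          then have "\<Gamma> H \<ge> (1 - \<delta>e) * ex_num r \<Gamma> n"
            using H\<Gamma>(2) by linarith
          then obtain F where F: "F \<subseteq> edges H" "real (card F) \<le> \<delta>c * real n ^ r" "del_edges H F \<in> \<HH>"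
            using stab H n(4) by blast
          \<comment> \<open>The deficit is \<open>2 * \<epsilon>\<close> for \<open>H\<close> plus
            \<open>\<sigma>\<close> from continuity, at most \<open>3 * \<sigma>\<close> in
            total.\<close>
          have between: "K \<in> rgraphs_on r n" "\<Gamma> K > 0" "\<Gamma> K \<ge> (1 - 3 * \<sigma>) * ex_num r \<Gamma> n"
            if K: "verts K = verts H" "edges H - F \<subseteq> edges K" "edges K \<subseteq> edges H" for K
          proof -
            show KR: "K \<in> rgraphs_on r n"
              using rgraphs_between[OF H K(1,3)] .
            have "finite (edges K)" "finite F"
              using K(3) F(1) HR(4) finite_subset by blast+
            have "card (edges H) \<le> card (edges K \<union> F)"
              using K(2) \<open>finite (edges K)\<close> \<open>finite F\<close> by (intro card_mono) auto
            also have "\<dots> \<le> card (edges K) + card F"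
              by (rule card_Un_le)
            finally have "real (card (edges K)) \<ge> real (card (edges H)) - \<delta>c * real n ^ r"
              using F(2) by linarith
            moreover have "subhgraph K H"
              using K by (simp add: subhgraph_def)
            ultimately have "\<Gamma> K \<ge> \<Gamma> H - \<sigma> * ex_num r \<Gamma> n"
              using cont n(3) H rgraphs_onD(1)[OF KR] by blast
            then have "\<Gamma> K \<ge> (1 - (\<epsilon> + \<epsilon> + \<sigma>)) * ex_num r \<Gamma> n"
              using H\<Gamma>(2) by (simp add: algebra_simps)
            moreover have "(1 - 3 * \<sigma>) * ex_num r \<Gamma> n \<le> (1 - (\<epsilon> + \<epsilon> + \<sigma>)) * ex_num r \<Gamma> n"
              using \<epsilon> ex_pos by (intro mult_right_mono) auto
            ultimately show K\<Gamma>: "\<Gamma> K \<ge> (1 - 3 * \<sigma>) * ex_num r \<Gamma> n"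
              by linarith
            have "(1 - 3 * \<sigma>) * ex_num r \<Gamma> n > 0"
              using \<sigma> ex_pos by simp
            with K\<Gamma> show "\<Gamma> K > 0"
              by linarith
          qed
          define H' where "H' = del_edges H F"
          have H': "verts H' = verts H" "edges H' = edges H - F"
            by (simp_all add: H'_def del_edges_def)
          note H'b = between[of H', unfolded H', OF refl order.refl Diff_subset]
          \<comment> \<open>Degrees are measured in the smallest graph of the range, so that
            monotonicity hands the bound on to every \<open>K\<close> above it.\<close>
          define Z where "Z = {v \<in> verts H'. gdeg \<Gamma> H' v < (1 - \<beta>) * exdeg r \<Gamma> k n}"
          have "\<gamma> \<le> 1" "\<gamma> < 1" "e \<le> 1"
            using \<gamma> e by auto
          have Z: "real (card Z) \<le> \<gamma> * real n"
            unfolding Z_def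
            by (rule card_low_degree_le[OF max mono H'b sm\<sigma> ex_pos \<open>k > 0\<close> bt(1) assms(9,8)
                  \<gamma>(1,2) \<open>\<gamma> \<le> 1\<close> \<gamma>cs \<sigma>(4) n\<gamma>])
          define S where "S = verts H - Z"
          have "Z \<subseteq> verts H"
            by (auto simp: Z_def H')
          then have S: "S \<subseteq> verts H" "real (card S) \<ge> (1 - \<gamma>) * real n"
            using Z HR by (auto simp: S_def card_Diff_subset finite_subset card_mono of_nat_diff algebra_simps)
          show ?thesis
          proof (rule extend_to_whole[OF her HR(1) \<open>r > 0\<close> F(3) S(1)])
            fix K T v
            assume K: "verts K = verts H" "edges H - F \<subseteq> edges K" "edges K \<subseteq> edges H"
              and T: "S \<subseteq> T" "T \<subseteq> verts H" "T = S \<or> K = H" "v \<in> T"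
              and del: "del_vertex (induced K T) v \<in> \<HH>"
            note Kb = between[OF K]
            have finT: "finite T" and TK: "T \<subseteq> verts K"
              using T(2) HR(3) K(1) by (auto intro: finite_subset)
            have "card S \<le> card T"
              using T(1) finT by (rule card_mono[rotated])
            then have cT: "real (card T) \<ge> (1 - \<gamma>) * real n"
              using S(2) by linarith
            have xpos: "exdeg r \<Gamma> k n > 0"
              using ex_pos \<open>k > 0\<close> n by (simp add: exdeg_def)
            \<comment> \<open>Vertices of \<open>Z\<close> may have low degree in \<open>H'\<close>,
              but they enter \<open>T\<close> only when \<open>K = H\<close>, where the minimum
              degree of \<open>H\<close> applies.\<close>
            have Kdeg: "gdeg \<Gamma> K u \<ge> (1 - \<beta>) * exdeg r \<Gamma> k n" if "u \<in> T" for u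
            proof (cases "K = H")
              case True
              have "(1 - \<beta>) * exdeg r \<Gamma> k n \<le> (1 - \<epsilon>) * exdeg r \<Gamma> k n"
                using \<epsilon> \<sigma> xpos by (intro mult_right_mono) auto
              then show ?thesis
                using Hdeg[of u] that T(2) True by force
            next
              case False
              then have "u \<in> S" and u: "u \<in> verts H'"
                using T that by (auto simp: H')
              then have "gdeg \<Gamma> H' u \<ge> (1 - \<beta>) * exdeg r \<Gamma> k n"
                by (auto simp: S_def Z_def)
              also have "gdeg \<Gamma> H' u \<le> gdeg \<Gamma> K u"
              proof -
                have "subhgraph H' K"
                  using K by (simp add: subhgraph_def H')
                then show ?thesis
                  using mono Kb(2) rgraphs_onD(1)[OF Kb(1)] rgraphs_onD(1)[OF H'b(1)] u
                  unfolding locally_monotone_def by blast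
              qed
              finally show ?thesis .
            qed
            have ind: "gdeg \<Gamma> (induced K T) u \<ge> (1 - e) * exdeg r \<Gamma> k (card T)" if "u \<in> T" for u
              by (rule gdeg_induced_ge[OF lip sm\<tau> Kb(1,2) TK cT that Kdeg[OF that] ex_pos \<open>k > 0\<close>
                    bt(1) assms(11,9,8) \<open>n > 0\<close> bt(2) \<gamma>(1,2) \<open>\<gamma> < 1\<close> \<gamma>e \<open>e \<le> 1\<close>])
            have "exdeg r \<Gamma> k (card T) \<ge> 0"
              using \<open>k > 0\<close> ex_num_nonneg[OF max nonneg] by (simp add: exdeg_def)
            then have "(1 - \<epsilon>0) * exdeg r \<Gamma> k (card T) \<le> (1 - e) * exdeg r \<Gamma> k (card T)"
              using e(2) by (intro mult_right_mono) auto
            then have "min_gdeg \<Gamma> (induced K T) \<ge> (1 - \<epsilon>0) * exdeg r \<Gamma> k (card T)"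
              using ind T(4) finT by (subst min_gdeg_ge_iff) (force simp: induced_def)+
            moreover have "induced K T \<in> rgraphs_on r (card T)"
              using induced_rgraphs_on[OF rgraphs_onD(1)[OF Kb(1)] TK] .
            moreover have "1 / 2 * real n \<le> (1 - \<gamma>) * real n"
              using \<gamma>(3) by (intro mult_right_mono) auto
            then have "card T \<ge> N0"
              using cT n(1) by linarith
            moreover have "v \<in> verts (induced K T)"
              using T(4) by (simp add: induced_def)
            ultimately show "induced K T \<in> \<HH>"
              using ext del by blast
          qed
        qed
      qed
    qed
    then show ?thesis
      unfolding degree_stable_def eventually_sequentially using \<epsilon>(1) by blast
  qed
qed

end
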